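(* Let $p$ be an odd prime and let $a$ be a positive integer. Then $$\sum_{k=0}^{p^a-1}\binom{p^a-1}{k}\frac{\binom{2k}{k}}{(-2)^k}\equiv(-1)^{(p^a-1)/2}\,2^{p-1}\pmod{p^2}.$$
   Context: Congruences modulo $p^2$ between rational numbers with denominators prime to $p$ are taken in the ring $\mathbb{Z}_p$ of $p$-adic integers. *)

theory Defs
  imports Complex_Main "HOL-Algebra.Ideal" "HOL-Number_Theory.Cong"
begin

text \<open>The ring of \<open>p\<close>-adic integers as the inverse limit of the rings of integers modulo
  \<open>p ^ n\<close>: an element is a compatible sequence of residues, the \<open>n\<close>-th one being represented
  in \<open>{0..<p ^ n}\<close>.\<close>

definition padic_int :: "nat \<Rightarrow> (nat \<Rightarrow> int) ring" where
  "padic_int p =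
    \<lparr>carrier = {x. \<forall>n. x n \<in> {0..<int p ^ n} \<and> x (Suc n) mod int p ^ n = x n},
     monoid.mult = (\<lambda>x y n. (x n * y n) mod int p ^ n),
     one = (\<lambda>n. 1 mod int p ^ n),
     zero = (\<lambda>n. 0),
     add = (\<lambda>x y n. (x n + y n) mod int p ^ n)\<rparr>"

definition padic_of_int :: "nat \<Rightarrow> int \<Rightarrow> nat \<Rightarrow> int" where
  "padic_of_int p a = (\<lambda>n. a mod int p ^ n)"

definition denom_prime_to :: "nat \<Rightarrow> rat \<Rightarrow> bool" where
  "denom_prime_to p x \<longleftrightarrow> coprime (snd (quotient_of x)) (int p)"

text \<open>Only meaningful if \<open>denom_prime_to p x\<close>; the denominator is then a unit, see
  \<open>padic_of_int_unit\<close> below.\<close>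

definition padic_of_rat :: "nat \<Rightarrow> rat \<Rightarrow> nat \<Rightarrow> int" where
  "padic_of_rat p x =
     padic_of_int p (fst (quotient_of x))
       \<otimes>\<^bsub>padic_int p\<^esub> inv\<^bsub>padic_int p\<^esub> (padic_of_int p (snd (quotient_of x)))"

text \<open>\<open>x \<equiv> y\<close> modulo \<open>m\<close> in the ring of \<open>p\<close>-adic integers, for rational \<open>x\<close>, \<open>y\<close>.\<close>

definition padic_cong :: "nat \<Rightarrow> rat \<Rightarrow> rat \<Rightarrow> int \<Rightarrow> bool" where
  "padic_cong p x y m \<longleftrightarrow>
     denom_prime_to p x \<and> denom_prime_to p y \<and>
     padic_of_rat p x \<ominus>\<^bsub>padic_int p\<^esub> padic_of_rat p y
       \<in> PIdl\<^bsub>padic_int p\<^esub> (padic_of_int p m)"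

lemma padic_int_sel:
  "x \<in> carrier (padic_int p) \<longleftrightarrow>
     (\<forall>n. x n \<in> {0..<int p ^ n} \<and> x (Suc n) mod int p ^ n = x n)"
  "x \<otimes>\<^bsub>padic_int p\<^esub> y = (\<lambda>n. (x n * y n) mod int p ^ n)"
  "x \<oplus>\<^bsub>padic_int p\<^esub> y = (\<lambda>n. (x n + y n) mod int p ^ n)"
  "\<one>\<^bsub>padic_int p\<^esub> = padic_of_int p 1"
  "\<zero>\<^bsub>padic_int p\<^esub> = padic_of_int p 0"
  by (simp_all add: padic_int_def padic_of_int_def)

lemma padic_carrierI:
  assumes "p > 0" and "\<And>n. [f (Suc n) = f n] (mod int p ^ n)"
  shows "(\<lambda>n. f n mod int p ^ n) \<in> carrier (padic_int p)"
  using assms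
  by (auto simp: padic_int_sel cong_def mod_mod_cancel)

lemma padic_carrierD:
  assumes "x \<in> carrier (padic_int p)"
  shows "x n mod int p ^ n = x n" and "[x (Suc n) = x n] (mod int p ^ n)"
proof -
  have *: "0 \<le> x n" "x n < int p ^ n" "x (Suc n) mod int p ^ n = x n"
    using assms by (auto simp: padic_int_sel)
  show "x n mod int p ^ n = x n" using * by simp
  thus "[x (Suc n) = x n] (mod int p ^ n)" using * by (simp add: cong_def)
qed

lemma padic_of_int_closed: "p > 0 \<Longrightarrow> padic_of_int p a \<in> carrier (padic_int p)"
  unfolding padic_of_int_def by (rule padic_carrierI) (auto simp: cong_def)

lemma cring_padic_int:
  assumes "p > 0"
  shows "cring (padic_int p)"
proof (rule cringI)
  show "abelian_group (padic_int p)"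
  proof (rule abelian_groupI)
    fix x y assume xy: "x \<in> carrier (padic_int p)" "y \<in> carrier (padic_int p)"
    show "x \<oplus>\<^bsub>padic_int p\<^esub> y \<in> carrier (padic_int p)"
      unfolding padic_int_sel(3)
      by (rule padic_carrierI) (use assms xy padic_carrierD(2) in \<open>auto intro: cong_add\<close>)
  next
    fix x assume x: "x \<in> carrier (padic_int p)"
    have "(\<lambda>n. (- x n) mod int p ^ n) \<in> carrier (padic_int p)"
      by (rule padic_carrierI)
         (use assms x padic_carrierD(2) in \<open>auto simp: cong_minus_minus_iff\<close>)
    thus "\<exists>y\<in>carrier (padic_int p). y \<oplus>\<^bsub>padic_int p\<^esub> x = \<zero>\<^bsub>padic_int p\<^esub>"
      by (rule bexI[rotated]) (auto simp: padic_int_sel padic_of_int_def mod_simps)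
  next
    show "\<zero>\<^bsub>padic_int p\<^esub> \<in> carrier (padic_int p)"
      using assms by (simp add: padic_int_sel(5) padic_of_int_closed)
  qed (auto simp: padic_int_sel(3,5) padic_of_int_def mod_simps add_ac padic_carrierD(1))
  show "comm_monoid (padic_int p)"
  proof (rule comm_monoidI)
    fix x y assume xy: "x \<in> carrier (padic_int p)" "y \<in> carrier (padic_int p)"
    show "x \<otimes>\<^bsub>padic_int p\<^esub> y \<in> carrier (padic_int p)"
      unfolding padic_int_sel(2)
      by (rule padic_carrierI) (use assms xy padic_carrierD(2) in \<open>auto intro: cong_mult\<close>)
  next
    show "\<one>\<^bsub>padic_int p\<^esub> \<in> carrier (padic_int p)"
      using assms by (simp add: padic_int_sel(4) padic_of_int_closed)
  qed (auto simp: padic_int_sel(2,4) padic_of_int_def mod_simps mult_ac padic_carrierD(1))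
qed (auto simp: padic_int_sel(2,3) mod_simps algebra_simps)

lemma padic_of_int_unit:
  assumes "p > 0" and "coprime d (int p)"
  shows "padic_of_int p d \<in> Units (padic_int p)"
proof -
  interpret cring "padic_int p" by (rule cring_padic_int) fact
  have "\<exists>c. [d * c = 1] (mod int p ^ n)" for n
    using assms(2) by (intro cong_solve_coprime_int) simp
  then obtain c where c: "\<And>n. [d * c n = 1] (mod int p ^ n)" by metis
  have "[c (Suc n) = c n] (mod int p ^ n)" for n
  proof -
    have "[d * c (Suc n) = 1] (mod int p ^ n)"
      using c[of "Suc n"] by (rule cong_dvd_modulus) simp
    hence "[d * c (Suc n) = d * c n] (mod int p ^ n)"
      using c[of n] by (metis cong_sym cong_trans)
    thus ?thesis
      using assms(2) by (subst (asm) cong_mult_lcancel) auto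
  qed
  hence "(\<lambda>n. c n mod int p ^ n) \<in> carrier (padic_int p)"
    using assms(1) by (rule padic_carrierI[rotated])
  moreover have "padic_of_int p d \<otimes>\<^bsub>padic_int p\<^esub> (\<lambda>n. c n mod int p ^ n) = \<one>\<^bsub>padic_int p\<^esub>"
    using c by (auto simp: padic_int_sel padic_of_int_def mod_simps cong_def)
  ultimately have
    "\<exists>w\<in>carrier (padic_int p). w \<otimes>\<^bsub>padic_int p\<^esub> padic_of_int p d = \<one>\<^bsub>padic_int p\<^esub> \<and>
       padic_of_int p d \<otimes>\<^bsub>padic_int p\<^esub> w = \<one>\<^bsub>padic_int p\<^esub>"
    using m_comm[OF padic_of_int_closed[OF assms(1)]] by (intro bexI conjI) auto
  thus ?thesis
    using padic_of_int_closed[OF assms(1)] unfolding Units_def by blast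
qed

text \<open>Congruence in the \<open>p\<close>-adic integers in terms of numerators and denominators.\<close>

lemma padic_cong_iff:
  assumes "p > 0" and "quotient_of x = (u, v)" and "quotient_of y = (u', v')"
  shows "padic_cong p x y (int p ^ k) \<longleftrightarrow>
           coprime v (int p) \<and> coprime v' (int p) \<and> int p ^ k dvd u * v' - u' * v"
proof (cases "coprime v (int p) \<and> coprime v' (int p)")
  case True
  interpret cring "padic_int p" by (rule cring_padic_int) fact
  let ?Z = "padic_int p" and ?i = "padic_of_int p"
  note cl = padic_of_int_closed[OF assms(1)]
  have un: "?i v \<in> Units ?Z" "?i v' \<in> Units ?Z" "?i (v * v') \<in> Units ?Z"
    using True assms(1) by (auto intro!: padic_of_int_unit)
  have im: "?i (a * b) = ?i a \<otimes>\<^bsub>?Z\<^esub> ?i b" and ia: "?i (a + b) = ?i a \<oplus>\<^bsub>?Z\<^esub> ?i b" for a b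
    by (auto simp: padic_int_sel padic_of_int_def mod_simps)
  have ineg: "?i (- a) = \<ominus>\<^bsub>?Z\<^esub> ?i a" for a
    using ia[of "-a" a] cl by (metis add.left_inverse minus_equality padic_int_sel(5))
  define z where "z = padic_of_rat p x \<ominus>\<^bsub>?Z\<^esub> padic_of_rat p y"
  have rat: "padic_of_rat p x = ?i u \<otimes>\<^bsub>?Z\<^esub> inv\<^bsub>?Z\<^esub> ?i v" "padic_of_rat p y = ?i u' \<otimes>\<^bsub>?Z\<^esub> inv\<^bsub>?Z\<^esub> ?i v'"
    by (simp_all add: padic_of_rat_def assms)
  have zc: "z \<in> carrier ?Z"
    unfolding z_def rat using un cl by (intro minus_closed m_closed Units_inv_closed) auto
  have A: "?i v \<otimes>\<^bsub>?Z\<^esub> padic_of_rat p x = ?i u" "?i v' \<otimes>\<^bsub>?Z\<^esub> padic_of_rat p y = ?i u'"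
    unfolding rat using un cl by (metis Units_inv_closed Units_r_inv m_lcomm r_one)+
  have rc: "padic_of_rat p x \<in> carrier ?Z" "padic_of_rat p y \<in> carrier ?Z"
    unfolding rat using un cl by auto
  have "?i (v * v') \<otimes>\<^bsub>?Z\<^esub> z =
      ?i v' \<otimes>\<^bsub>?Z\<^esub> (?i v \<otimes>\<^bsub>?Z\<^esub> padic_of_rat p x) \<ominus>\<^bsub>?Z\<^esub> ?i v \<otimes>\<^bsub>?Z\<^esub> (?i v' \<otimes>\<^bsub>?Z\<^esub> padic_of_rat p y)"
    unfolding z_def im a_minus_def using cl rc
    by (simp add: r_distr r_minus m_ac)
  also have "\<dots> = ?i (u * v' - u' * v)"
    unfolding A using im[of u v'] im[of u' v] ia[of "u * v'" "- (u' * v)"] ineg[of "u' * v"] cl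
    by (simp add: a_minus_def m_comm)
  finally have z: "?i (v * v') \<otimes>\<^bsub>?Z\<^esub> z = ?i (u * v' - u' * v)" .
  have "z \<in> PIdl\<^bsub>?Z\<^esub> ?i (int p ^ k) \<longleftrightarrow> int p ^ k dvd u * v' - u' * v"
  proof
    assume "z \<in> PIdl\<^bsub>?Z\<^esub> ?i (int p ^ k)"
    then obtain w where "z = w \<otimes>\<^bsub>?Z\<^esub> ?i (int p ^ k)"
      by (auto simp: cgenideal_def)
    hence "z k = 0" by (simp add: padic_int_sel padic_of_int_def)
    moreover have "(v * v' * z k) mod int p ^ k = (u * v' - u' * v) mod int p ^ k"
      using fun_cong[OF z, of k] by (simp add: padic_int_sel padic_of_int_def mod_simps)
    ultimately show "int p ^ k dvd u * v' - u' * v" by (simp add: dvd_eq_mod_eq_0)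
  next
    assume "int p ^ k dvd u * v' - u' * v"
    then obtain t where t: "u * v' - u' * v = t * int p ^ k" by (metis dvd_div_mult_self)
    have "z = inv\<^bsub>?Z\<^esub> ?i (v * v') \<otimes>\<^bsub>?Z\<^esub> (?i (v * v') \<otimes>\<^bsub>?Z\<^esub> z)"
      using un(3) zc cl by (metis Units_inv_closed Units_l_inv l_one m_assoc)
    also have "\<dots> = (inv\<^bsub>?Z\<^esub> ?i (v * v') \<otimes>\<^bsub>?Z\<^esub> ?i t) \<otimes>\<^bsub>?Z\<^esub> ?i (int p ^ k)"
      unfolding z t im[of t] using un(3) cl by (intro m_assoc[symmetric]) auto
    finally show "z \<in> PIdl\<^bsub>?Z\<^esub> ?i (int p ^ k)"
      unfolding cgenideal_def using un(3) cl by blast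
  qed
  thus ?thesis
    using True by (simp add: padic_cong_def denom_prime_to_def assms z_def)
qed (auto simp: padic_cong_def denom_prime_to_def assms)

end

theory Submission
  imports Defs "HOL-Number_Theory.Residues" "HOL-Computational_Algebra.Polynomial"
begin

text \<open>With \<open>p ^ a - 1 = 2 m\<close>, comparing coefficients of \<open>x ^ (2 m)\<close> in
  \<open>(1 + x\<^sup>2) ^ (2 m) = ((1 + x)\<^sup>2 - 2 x) ^ (2 m)\<close> shows that the sum equals
  \<open>(2 m choose m) / 2 ^ (2 m)\<close> exactly. Modulo \<open>p ^ 2\<close> the binomial coefficient reduces, up to sign,
  to the case \<open>a = 1\<close>, where Morley's congruence gives \<open>4 ^ (p - 1)\<close>; and
  \<open>2 ^ (p ^ a - 1) \<equiv> 2 ^ (p - 1)\<close> by Euler's theorem.\<close>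

section \<open>Congruences between fractions and integers\<close>

text \<open>Lets a fraction be treated without reducing it: the reduced denominator \<open>v\<close>
  divides \<open>d\<close>, so it stays prime to \<open>p\<close>, and
  \<open>v * (c - e * d) = d * (u - e * v)\<close>, where the unit \<open>d\<close> can be cancelled
  modulo \<open>p ^ k\<close>.\<close>

lemma padic_cong_fraction_intI:
  assumes "p > 0" and "coprime d (int p)" and "[c = e * d] (mod int p ^ k)"
    and "d \<noteq> 0"
  shows "padic_cong p (of_int c / of_int d) (of_int e) (int p ^ k)"
proof -
  obtain u v where uv: "quotient_of (of_int c / of_int d) = (u, v)"
    by (metis surj_pair)
  have v: "v > 0" and cop: "coprime u v"
    using uv quotient_of_denom_pos quotient_of_coprime by blast+
  have "(of_int c / of_int d :: rat) = of_int u / of_int v"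
    using uv by (rule quotient_of_div)
  hence "(of_int (u * d) :: rat) = of_int (c * v)"
    using v assms(4) by (simp add: field_simps)
  hence eq: "u * d = c * v" by (simp only: of_int_eq_iff)
  hence "v dvd d" using cop by (metis coprime_commute coprime_dvd_mult_right_iff dvd_triv_right)
  hence vp: "coprime v (int p)" using assms(2) by (meson coprime_divisors dvd_refl)
  have "int p ^ k dvd v * (c - e * d)"
    using assms(3) by (simp add: cong_iff_dvd_diff)
  also have "v * (c - e * d) = d * (u - e * v)" using eq by (simp add: algebra_simps)
  finally have "int p ^ k dvd u - e * v"
    using assms(2) by (metis coprime_commute coprime_dvd_mult_right_iff coprime_power_left_iff)
  moreover have "quotient_of (of_int e) = (e, 1)" by simp
  ultimately show ?thesis
    using padic_cong_iff[OF assms(1) uv, of "of_int e" e 1 k] vp by simp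
qed

section \<open>Closed form of the sum\<close>

text \<open>Multiplying the sum by \<open>(- 2) ^ (2 * m)\<close> clears the denominators, so the
  coefficients can be compared in integer polynomials.\<close>

lemma sum_choose_central_binomial:
  "(\<Sum>k\<le>2 * m. int ((2 * m) choose k) * (- 2) ^ (2 * m - k) * int ((2 * k) choose k))
     = int ((2 * m) choose m)"
proof -
  let ?n = "2 * m"
  have sq: "[:1, 1:] ^ 2 + monom (-2) 1 = (monom 1 2 + 1 :: int poly)"
    by (simp add: power2_eq_square monom_altdef numeral_2_eq_2 one_pCons)
  have "(\<Sum>k\<le>?n. int (?n choose k) * (- 2) ^ (?n - k) * int ((2 * k) choose k))
      = (\<Sum>k\<le>?n. coeff (of_nat (?n choose k) * ([:1, 1:] ^ 2) ^ k * monom (-2) 1 ^ (?n - k)) ?n)"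
  proof (rule sum.cong)
    fix k assume "k \<in> {..?n}"
    \<comment> \<open>The monomial shifts by \<open>?n - k\<close>, so the coefficient at
      \<open>?n\<close> is that of \<open>x ^ k\<close> in \<open>(1 + x) ^ (2 * k)\<close>.\<close>
    have "of_nat (?n choose k) * ([:1, 1:] ^ 2) ^ k * monom (-2) 1 ^ (?n - k)
       = smult (int (?n choose k)) (monom ((-2) ^ (?n - k)) (?n - k) * [:1, 1:] ^ (2 * k))"
      by (simp add: of_nat_poly monom_power mult_ac flip: power_mult)
    thus "int (?n choose k) * (- 2) ^ (?n - k) * int ((2 * k) choose k)
       = coeff (of_nat (?n choose k) * ([:1, 1:] ^ 2) ^ k * monom (-2) 1 ^ (?n - k)) ?n"
      using \<open>k \<in> _\<close> by (simp add: coeff_monom_mult coeff_linear_poly_power)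
  qed simp
  also have "\<dots> = coeff (([:1, 1:] ^ 2 + monom (-2) 1) ^ ?n) ?n"
    by (subst binomial_ring) (simp add: coeff_sum)
  also have "\<dots> = (\<Sum>k\<le>?n. coeff (monom (int (?n choose k)) (2 * k)) ?n)"
    unfolding sq by (subst binomial_ring) (simp add: coeff_sum monom_power of_nat_poly smult_monom)
  also have "\<dots> = (\<Sum>k\<le>?n. if k = m then int (?n choose k) else 0)"
    by (rule sum.cong) auto
  also have "\<dots> = int (?n choose m)" by simp
  finally show ?thesis .
qed

section \<open>The central binomial coefficient modulo \<open>p ^ 2\<close>\<close>

text \<open>This is \<open>(2 * m)! / m!\<close> with its factors in descending order, which makes
  each of them congruent to \<open>- j\<close> modulo \<open>2 * m + 1\<close>.\<close>

lemma choose_half_mult_fact: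
  "int ((2 * m) choose m) * fact m = (\<Prod>j=1..m. int (2 * m + 1) - int j)"
proof -
  have "fact m * fact m * ((2 * m) choose m) = (fact (2 * m) :: nat)"
    using binomial_fact_lemma[of m "2 * m"] by simp
  also have "\<dots> = fact m * (\<Prod>j=m+1..2*m. j)"
    using prod.ub_add_nat[of 1 m "\<lambda>j. j" m] by (simp add: fact_prod mult_2)
  finally have "fact m * ((2 * m) choose m) = (\<Prod>j=m+1..2*m. j)" by simp
  also have "\<dots> = (\<Prod>j=1..m. 2 * m + 1 - j)"
    by (rule prod.reindex_bij_witness[of _ "\<lambda>j. 2*m+1-j" "\<lambda>j. 2*m+1-j"]) auto
  finally have "int (fact m * ((2 * m) choose m)) = int (\<Prod>j=1..m. 2 * m + 1 - j)" by simp
  thus ?thesis by (simp add: of_nat_diff mult.commute)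
qed

text \<open>Splitting \<open>(2 * m)!\<close> into even and odd factors gives
  \<open>2 ^ m * m!\<close> times the odd numbers below \<open>2 * m\<close>, again listed in
  descending order.\<close>

lemma choose_half_mult_fact_odds:
  "int ((2 * m) choose m) * fact m = 2 ^ m * (\<Prod>j=1..m. int (2 * m + 1) - 2 * int j)"
proof -
  have "(\<Prod>j=1..m. int (2 * m + 1) - 2 * int j) = (\<Prod>j=1..m. 2 * int j - 1)"
    by (rule prod.reindex_bij_witness[of _ "\<lambda>j. m+1-j" "\<lambda>j. m+1-j"]) (auto simp: of_nat_diff)
  moreover have "fact (2 * m) = 2 ^ m * fact m * (\<Prod>j=1..m. 2 * int j - 1)"
    by (induction m) (simp_all add: algebra_simps)
  moreover have "fact m * fact m * int ((2 * m) choose m) = fact (2 * m)"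
    using arg_cong[OF binomial_fact_lemma[of m "2 * m"], of int] by simp
  ultimately have "fact m * (int ((2 * m) choose m) * fact m)
    = fact m * (2 ^ m * (\<Prod>j=1..m. int (2 * m + 1) - 2 * int j))"
    by (simp add: mult_ac)
  thus ?thesis by simp
qed

lemma coprime_fact_prime:
  assumes "prime p" and "m < p"
  shows "coprime (fact m :: int) (int p)"
proof -
  have "coprime (fact m) p"
    using assms by (simp add: prime_imp_coprime prime_dvd_fact_iff coprime_commute)
  hence "coprime (int (fact m)) (int p)" by (simp only: coprime_int_iff)
  thus ?thesis by simp
qed

text \<open>Pairing the two product formulas for the central binomial coefficient, the squares of the
  factors \<open>p - 2 j\<close> of the second agree modulo \<open>p ^ 2\<close> with \<open>- 4 j\<close> times the factors \<open>p - j\<close> of the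
  first.\<close>

lemma morley_mod_square:
  assumes "prime p" and p: "p = 2 * m + 1"
  shows "[int ((2 * m) choose m) = (- 1) ^ m * 16 ^ m] (mod int p ^ 2)"
proof -
  define C where "C = int ((2 * m) choose m)"
  define A where "A = (\<Prod>j=1..m. int p - 2 * int j)"
  define B where "B = (\<Prod>j=1..m. int p - int j)"
  define F where "F = (fact m :: int)"
  have CB: "C * F = B" and CA: "C * F = 2 ^ m * A"
    unfolding A_def B_def C_def F_def p
    by (rule choose_half_mult_fact choose_half_mult_fact_odds)+
  have "[A ^ 2 = (\<Prod>j=1..m. (-4) * int j * (int p - int j))] (mod int p ^ 2)"
    unfolding A_def prod_power_distrib
    by (rule cong_prod) (simp add: cong_iff_dvd_diff power2_eq_square algebra_simps)
  also have "(\<Prod>j=1..m. (-4) * int j * (int p - int j)) = (-4) ^ m * F * B"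
    unfolding prod.distrib by (simp add: B_def F_def fact_prod)
  \<comment> \<open>The factor \<open>4 ^ m\<close> completes \<open>A ^ 2\<close> to
    \<open>(2 ^ m * A) ^ 2 = (C * F) ^ 2\<close>; with \<open>B = C * F\<close> both sides then
    share the factor \<open>C * F ^ 2\<close>.\<close>
  finally have "[4 ^ m * A ^ 2 = 4 ^ m * ((-4) ^ m * F * B)] (mod int p ^ 2)"
    by (rule cong_scalar_left)
  also have "4 ^ m * A ^ 2 = (C * F) ^ 2"
    unfolding CA by (simp add: power2_eq_square mult_ac flip: power_mult_distrib)
  also have "4 ^ m * ((-4) ^ m * F * B) = (C * F\<^sup>2) * ((- 1) ^ m * 16 ^ m)"
    by (simp add: CB[symmetric] power2_eq_square power_mult_distrib[symmetric] mult_ac)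
  finally have "[(C * F\<^sup>2) * C = (C * F\<^sup>2) * ((- 1) ^ m * 16 ^ m)] (mod int p ^ 2)"
    by (simp add: power2_eq_square mult_ac)
  \<comment> \<open>The common factor is \<open>(2 * m)! = (p - 1)!\<close>, a unit modulo
    \<open>p ^ 2\<close>.\<close>
  moreover have "coprime (C * F\<^sup>2) (int p ^ 2)"
  proof -
    have "fact m * fact m * C = fact (2 * m)"
      using arg_cong[OF binomial_fact_lemma[of m "2 * m"], of int] by (simp add: C_def)
    hence "C * F\<^sup>2 = fact (2 * m)" by (simp add: F_def power2_eq_square mult_ac)
    thus ?thesis using coprime_fact_prime[OF assms(1), of "2 * m"] p by simp
  qed
  ultimately have "[C = (- 1) ^ m * 16 ^ m] (mod int p ^ 2)"
    by (simp only: cong_mult_lcancel)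
  thus ?thesis by (simp add: C_def)
qed

text \<open>In \<open>(2 m choose m) = (\<Prod>j=1..m. (2 m + 1 - j) / j)\<close>, the factors with \<open>p dvd j\<close> make up
  \<open>2 n choose n\<close>, and each of the others is congruent to \<open>-1\<close> because \<open>p ^ 2 dvd 2 m + 1\<close>.\<close>

lemma choose_half_descent:
  assumes "prime p" and "p dvd 2 * n + 1" and m: "2 * m + 1 = p * (2 * n + 1)"
  shows "[int ((2 * m) choose m) = (- 1) ^ (m - n) * int ((2 * n) choose n)] (mod int p ^ 2)"
proof -
  define N where "N = int (2 * m + 1)"
  define U where "U = {j \<in> {1..m}. \<not> p dvd j}"
  have p0: "p > 0" using assms(1) prime_gt_0_nat by blast
  have "odd (p * (2 * n + 1))" unfolding m[symmetric] by simp
  hence "odd p" by simp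
  then obtain h where h: "p = 2 * h + 1" by (rule oddE)
  have mh: "m = p * n + h" using m h by (simp add: algebra_simps)
  \<comment> \<open>Since \<open>m = p * n + h\<close> with \<open>h < p\<close>, the last multiple
    of \<open>p\<close> up to \<open>m\<close> is \<open>p * n\<close>.\<close>
  have mul: "{j \<in> {1..m}. p dvd j} = (*) p ` {1..n}"
  proof (intro equalityI subsetI)
    fix j assume j: "j \<in> {j \<in> {1..m}. p dvd j}"
    then obtain i where i: "j = p * i" by auto
    have "p * i < p * (n + 1)" using i j mh h by (auto simp: algebra_simps)
    hence "i < n + 1" by (metis mult_less_cancel1)
    moreover have "i \<noteq> 0" using i j by auto
    ultimately have "i \<in> {1..n}" by simp
    thus "j \<in> (*) p ` {1..n}" unfolding i by (rule imageI)
  next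
    fix j assume "j \<in> (*) p ` {1..n}"
    then obtain i where "j = p * i" "i \<in> {1..n}" by (rule imageE)
    thus "j \<in> {j \<in> {1..m}. p dvd j}"
      using p0 mh by (auto simp: Suc_le_eq intro: trans_le_add1)
  qed
  have inj: "inj_on ((*) p) {1..n}" using p0 by (auto intro: inj_onI)
  have split: "{1..m} = U \<union> (*) p ` {1..n}" and disj: "U \<inter> (*) p ` {1..n} = {}"
    and fin: "finite U"
    unfolding mul[symmetric] U_def by auto
  have prod_split: "(\<Prod>j=1..m. f j) = (\<Prod>j\<in>U. f j) * (\<Prod>i=1..n. f (p * i))"
    for f :: "nat \<Rightarrow> int"
    unfolding split using disj fin by (simp add: prod.union_disjoint prod.reindex[OF inj, unfolded One_nat_def])
  have "card {1..m} = card U + n"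
    unfolding split using card_Un_disjoint[OF fin _ disj] card_image[OF inj] by simp
  hence card: "card U = m - n" by simp
  have "int ((2 * m) choose m) * fact m = (\<Prod>j\<in>U. N - int j) * (\<Prod>i=1..n. N - int (p * i))"
    unfolding choose_half_mult_fact N_def[symmetric] by (rule prod_split)
  also have "(\<Prod>i=1..n. N - int (p * i)) = (\<Prod>i=1..n. int p * (int (2 * n + 1) - int i))"
    unfolding N_def m by (simp add: algebra_simps)
  also have "\<dots> = int p ^ n * (int ((2 * n) choose n) * fact n)"
    unfolding choose_half_mult_fact by (simp add: prod.distrib)
  finally have 1: "int ((2 * m) choose m) * fact m
    = (\<Prod>j\<in>U. N - int j) * (int p ^ n * (int ((2 * n) choose n) * fact n))" .
  have "(fact m :: int) = (\<Prod>j\<in>U. int j) * (int p ^ n * fact n)"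
    using prod_split[of int] by (simp add: fact_prod prod.distrib)
  \<comment> \<open>The factors from multiples of \<open>p\<close> are not units modulo
    \<open>p ^ 2\<close>, so they are cancelled in an exact integer equation before any congruence
    is taken.\<close>
  with 1 have "(int p ^ n * fact n) * (int ((2 * m) choose m) * (\<Prod>j\<in>U. int j))
    = (int p ^ n * fact n) * (int ((2 * n) choose n) * (\<Prod>j\<in>U. N - int j))"
    by (simp add: mult_ac)
  hence 2: "int ((2 * m) choose m) * (\<Prod>j\<in>U. int j)
    = int ((2 * n) choose n) * (\<Prod>j\<in>U. N - int j)"
    using p0 by simp
  have "int p ^ 2 dvd N"
    using assms(2) unfolding N_def m power2_eq_square
    by (metis mult_dvd_mono dvd_refl of_nat_dvd_iff of_nat_mult)
  hence "[(\<Prod>j\<in>U. N - int j) = (\<Prod>j\<in>U. (- 1) * int j)] (mod int p ^ 2)"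
    by (intro cong_prod) (simp add: cong_iff_dvd_diff)
  also have "(\<Prod>j\<in>U. (- 1) * int j) = (- 1) ^ (m - n) * (\<Prod>j\<in>U. int j)"
    by (simp only: prod.distrib prod_constant card)
  finally have "[int ((2 * m) choose m) * (\<Prod>j\<in>U. int j)
    = int ((2 * n) choose n) * ((- 1) ^ (m - n) * (\<Prod>j\<in>U. int j))] (mod int p ^ 2)"
    unfolding 2 by (rule cong_scalar_left)
  hence "[int ((2 * m) choose m) * (\<Prod>j\<in>U. int j)
    = ((- 1) ^ (m - n) * int ((2 * n) choose n)) * (\<Prod>j\<in>U. int j)] (mod int p ^ 2)"
    by (simp add: mult_ac)
  moreover have "coprime (\<Prod>j\<in>U. int j) (int p ^ 2)"
  proof (rule prod_coprime_left)
    fix j assume "j \<in> U"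
    hence "coprime p j" using assms(1) by (simp add: U_def prime_imp_coprime)
    thus "coprime (int j) (int p ^ 2)" by (simp add: coprime_commute)
  qed
  ultimately show ?thesis by (simp only: cong_mult_rcancel)
qed

lemma odd_prime_power_half:
  assumes "odd (p :: nat)"
  shows "2 * ((p ^ b - 1) div 2) + 1 = p ^ b"
proof -
  have "odd (p ^ b)" using assms by simp
  then obtain k where "p ^ b = 2 * k + 1" by (rule oddE)
  thus ?thesis by simp
qed

text \<open>Induction on the exponent, started at \<open>p ^ 1\<close> because the descent requires
  \<open>p dvd 2 * n + 1\<close>. The base case is Morley's congruence, where
  \<open>16 ^ h 0 = 4 ^ (p - 1)\<close>.\<close>

lemma prime_power_choose_half:
  assumes "prime p" and "odd p"
  defines "h \<equiv> \<lambda>b. (p ^ Suc b - 1) div 2"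
  shows "[int ((2 * h b) choose h b) = (- 1) ^ h b * 4 ^ (p - 1)] (mod int p ^ 2)"
proof (induction b)
  have h: "2 * h b + 1 = p ^ Suc b" for b
    unfolding h_def using assms(2) by (rule odd_prime_power_half)
  {
    case 0
    have p: "p = 2 * h 0 + 1" using h[of 0] by simp
    hence "p - 1 = 2 * h 0" by simp
    hence "4 ^ (p - 1) = (16 ^ h 0 :: int)" by (simp add: power_mult)
    thus ?case using morley_mod_square[OF assms(1) p] by simp
  next
    case (Suc b)
    have "p dvd 2 * h b + 1" "2 * h (Suc b) + 1 = p * (2 * h b + 1)"
      unfolding h by simp_all
    from choose_half_descent[OF assms(1) this]
    have "[int ((2 * h (Suc b)) choose h (Suc b))
      = (- 1) ^ (h (Suc b) - h b) * int ((2 * h b) choose h b)] (mod int p ^ 2)" .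
    also have "[(- 1) ^ (h (Suc b) - h b) * int ((2 * h b) choose h b)
      = (- 1) ^ (h (Suc b) - h b) * ((- 1) ^ h b * 4 ^ (p - 1))] (mod int p ^ 2)"
      using Suc.IH by (rule cong_scalar_left)
    \<comment> \<open>Ensures that the truncated difference \<open>h (Suc b) - h b\<close> is the
      true one, so that the signs combine.\<close>
    also have "h b \<le> h (Suc b)"
      unfolding h_def using prime_gt_0_nat[OF assms(1)]
      by (intro div_le_mono diff_le_mono power_increasing) auto
    hence "(- 1) ^ (h (Suc b) - h b) * ((- 1) ^ h b * 4 ^ (p - 1)) = (- 1) ^ h (Suc b) * (4 ^ (p - 1) :: int)"
      by (simp flip: mult.assoc power_add)
    finally show ?case .
  }
qed

section \<open>Powers of 2 modulo \<open>p ^ 2\<close>\<close>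

text \<open>Passing from \<open>b\<close> to \<open>Suc b\<close> raises the exponent by
  \<open>p * (p - 1) * p ^ b\<close>, a multiple of the totient \<open>p * (p - 1)\<close> of
  \<open>p ^ 2\<close>.\<close>

lemma two_power_prime_power:
  assumes "prime p" and "odd p"
  shows "[2 ^ (p ^ Suc b - 1) = 2 ^ (p - 1)] (mod int p ^ 2)"
proof (induction b)
  case (Suc b)
  have p0: "p > 0" using assms(1) prime_gt_0_nat by blast
  have "coprime 2 (p ^ 2)" using assms(2) by simp
  from euler_theorem[OF this]
  have "[2 ^ (p * (p - 1)) = 1] (mod p ^ 2)"
    using totient_prime_power[OF assms(1), of 2] by simp
  hence "[2 ^ (p * (p - 1)) = 1] (mod int p ^ 2)"
    by (metis cong_int_iff of_nat_1 of_nat_numeral of_nat_power)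
  hence "[(2 ^ (p * (p - 1))) ^ (p ^ b) = 1] (mod int p ^ 2)"
    using cong_pow[of "2 ^ (p * (p - 1))" 1] by fastforce
  from cong_mult[OF Suc.IH this]
  have "[2 ^ (p ^ Suc b - 1) * (2 ^ (p * (p - 1))) ^ (p ^ b) = 2 ^ (p - 1)] (mod int p ^ 2)"
    by simp
  also have "2 ^ (p ^ Suc b - 1) * (2 ^ (p * (p - 1))) ^ (p ^ b)
    = (2 ^ (p ^ Suc b - 1 + p * (p - 1) * p ^ b) :: int)"
    by (simp only: power_add power_mult)
  also have "p ^ Suc b - 1 + p * (p - 1) * p ^ b = p ^ Suc (Suc b) - 1"
  proof -
    obtain q t where "p = Suc q" "p ^ b = Suc t"
      using p0 by (metis Suc_pred zero_less_power)
    thus ?thesis by (simp add: algebra_simps)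
  qed
  finally show ?case .
qed simp

theorem corollary1p1:
  fixes p a :: nat
  assumes "prime p" and "odd p" and "a > 0"
  shows "padic_cong p
           (\<Sum>k = 0..p ^ a - 1.
              of_nat ((p ^ a - 1) choose k) * (of_nat ((2 * k) choose k) / (- 2) ^ k))
           ((- 1) ^ ((p ^ a - 1) div 2) * 2 ^ (p - 1))
           (int p ^ 2)"
proof -
  define m where "m = (p ^ a - 1) div 2"
  obtain b where b: "a = Suc b" using assms(3) by (cases a) auto
  have m: "p ^ a - 1 = 2 * m"
    using odd_prime_power_half[OF assms(2), of a] unfolding m_def by simp
  have "(\<Sum>k = 0..2 * m. of_nat ((2 * m) choose k) * (of_nat ((2 * k) choose k) / (- 2) ^ k))
    = (\<Sum>k\<le>2 * m. of_nat ((2 * m) choose k) * (- 2) ^ (2 * m - k) * of_nat ((2 * k) choose k))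
        / (2 ^ (2 * m) :: rat)"
    unfolding sum_divide_distrib atMost_atLeast0
  proof (rule sum.cong)
    fix k assume "k \<in> {0..2 * m}"
    \<comment> \<open>The sign disappears because the total exponent \<open>2 * m\<close> is
      even.\<close>
    hence "(2 :: rat) ^ (2 * m) = (- 2) ^ k * (- 2) ^ (2 * m - k)"
      by (simp flip: power_add)
    thus "of_nat ((2 * m) choose k) * (of_nat ((2 * k) choose k) / (- 2) ^ k)
      = of_nat ((2 * m) choose k) * (- 2) ^ (2 * m - k) * of_nat ((2 * k) choose k)
        / (2 ^ (2 * m) :: rat)"
      by simp
  qed simp
  also have "\<dots> = of_int (int ((2 * m) choose m)) / of_int (2 ^ (2 * m))"
    unfolding sum_choose_central_binomial[of m, symmetric] by simp
  finally have sum: "(\<Sum>k = 0..2 * m. of_nat ((2 * m) choose k) * (of_nat ((2 * k) choose k) / (- 2) ^ k))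
    = (of_int (int ((2 * m) choose m)) / of_int (2 ^ (2 * m)) :: rat)" .
  \<comment> \<open>Cross-multiplied form of the goal: one factor \<open>2 ^ (p - 1)\<close> is the
    claimed value, the other comes from the denominator \<open>2 ^ (2 * m)\<close>, and together
    they match Morley's \<open>4 ^ (p - 1)\<close>.\<close>
  have "[(- 1) ^ m * 2 ^ (p - 1) * 2 ^ (2 * m) = (- 1) ^ m * 2 ^ (p - 1) * 2 ^ (p - 1)]
      (mod int p ^ 2)"
    using two_power_prime_power[OF assms(1,2), of b] unfolding b[symmetric] m
    by (rule cong_scalar_left)
  hence "[(- 1) ^ m * 2 ^ (p - 1) * 2 ^ (2 * m) = (- 1) ^ m * 4 ^ (p - 1)] (mod int p ^ 2)"
    by (simp add: mult.assoc flip: power_mult_distrib)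
  moreover have "[int ((2 * m) choose m) = (- 1) ^ m * 4 ^ (p - 1)] (mod int p ^ 2)"
    using prime_power_choose_half[OF assms(1,2), of b] unfolding b[symmetric] m_def[symmetric] .
  ultimately have "[int ((2 * m) choose m) = (- 1) ^ m * 2 ^ (p - 1) * 2 ^ (2 * m)]
      (mod int p ^ 2)"
    using cong_sym cong_trans by blast
  moreover have "coprime (2 ^ (2 * m)) (int p)" using assms(2) by simp
  ultimately have "padic_cong p (of_int (int ((2 * m) choose m)) / of_int (2 ^ (2 * m)))
      (of_int ((- 1) ^ m * 2 ^ (p - 1))) (int p ^ 2)"
    using prime_gt_0_nat[OF assms(1)] by (intro padic_cong_fraction_intI) auto
  thus ?thesis unfolding m sum by simp
qed

end
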